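(* Assume one of the following two settings. (a) $\mathcal{A}$ is a unital associative complex algebra, $\mathcal{M}$ is a unital $\mathcal{A}$-bimodule satisfying property $\mathbb{M}$, and $D:\mathcal{A}\to\mathcal{M}$ is a linear map. (b) $\mathcal{A}$ is a unital complex Banach algebra, $\mathcal{M}$ is a unital Banach $\mathcal{A}$-bimodule satisfying property $\mathbb{M}'$, and $D:\mathcal{A}\to\mathcal{M}$ is a continuous linear map. Then, in either setting, the following conditions are equivalent: (i) $D$ is a generalized Jordan derivation and $aD(1)=D(1)a$ for all $a\in\mathcal{A}$; (ii) for all $a,b\in\mathcal{A}$, $a\circ b=0$ implies $a\bullet D(b)+D(a)\bullet b=0$; (iii) for all $a,b\in\mathcal{A}$, $ab=ba=0$ implies $a\bullet D(b)+D(a)\bullet b=0$.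
   Context: All algebras are associative and unital over $\mathbb{C}$, and all modules are unital. $a\circ b=ab+ba$ for $a,b\in\mathcal{A}$, and $a\bullet m=m\bullet a=am+ma$ for $a\in\mathcal{A}$, $m\in\mathcal{M}$. $\mathfrak{I}(\mathcal{A})$ denotes the set of all (finite) linear combinations of idempotents of $\mathcal{A}$; $\overline{\mathfrak{I}(\mathcal{A})}$ is its norm closure when $\mathcal{A}$ is a Banach algebra. An $\mathcal{A}$-bimodule $\mathcal{M}$ satisfies property $\mathbb{M}$ if there is a (two-sided) ideal $\mathcal{J}$ of $\mathcal{A}$ with $\mathcal{J}\subseteq\mathfrak{I}(\mathcal{A})$ and $\{m\in\mathcal{M}\mid xmx=0 \text{ for all } x\in\mathcal{J}\}=\{0\}$. If $\mathcal{A}$ is a Banach algebra and $\mathcal{M}$ is a Banach $\mathcal{A}$-bimodule, $\mathcal{M}$ satisfies property $\mathbb{M}'$ if there is a (two-sided) ideal $\mathcal{J}$ of $\mathcal{A}$ with $\mathcal{J}\subseteq\overline{\mathfrak{I}(\mathcal{A})}$ and $\{m\in\mathcal{M}\mid xmx=0 \text{ for all } x\in\mathcal{J}\}=\{0\}$. A linear map $D:\mathcal{A}\to\mathcal{M}$ is a generalized Jordan derivation if $D(a\circ b)=D(a)\bullet b+a\bullet D(b)-aD(1)b-bD(1)a$ for all $a,b\in\mathcal{A}$. *)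

theory Defs
  imports "HOL-Analysis.Analysis"
begin

text \<open>
  The carrier sort is \<open>{ring, monoid_mult}\<close> rather than \<open>ring_1\<close>, so that the zero algebra
  (\<open>1 = 0\<close>) is not excluded. Complex scalar multiplication is an explicit parameter.
\<close>

locale complex_algebra = vector_space scaleA
  for scaleA :: "complex \<Rightarrow> 'a::{ring, monoid_mult} \<Rightarrow> 'a" +
  assumes scale_mult_left: "scaleA c x * y = scaleA c (x * y)"
    and scale_mult_right: "x * scaleA c y = scaleA c (x * y)"

locale unital_bimodule =
  A: complex_algebra scaleA + M: vector_space scaleM
  for scaleA :: "complex \<Rightarrow> 'a::{ring, monoid_mult} \<Rightarrow> 'a"
    and scaleM :: "complex \<Rightarrow> 'm::ab_group_add \<Rightarrow> 'm" +
  fixes lact :: "'a \<Rightarrow> 'm \<Rightarrow> 'm"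
    and ract :: "'m \<Rightarrow> 'a \<Rightarrow> 'm"
  assumes lact_add_left: "lact (a + b) m = lact a m + lact b m"
    and lact_add_right: "lact a (m + n) = lact a m + lact a n"
    and lact_scale_left: "lact (scaleA c a) m = scaleM c (lact a m)"
    and lact_scale_right: "lact a (scaleM c m) = scaleM c (lact a m)"
    and ract_add_left: "ract (m + n) a = ract m a + ract n a"
    and ract_add_right: "ract m (a + b) = ract m a + ract m b"
    and ract_scale_left: "ract (scaleM c m) a = scaleM c (ract m a)"
    and ract_scale_right: "ract m (scaleA c a) = scaleM c (ract m a)"
    and lact_mult: "lact (a * b) m = lact a (lact b m)"
    and ract_mult: "ract m (a * b) = ract (ract m a) b"
    and lact_ract: "ract (lact a m) b = lact a (ract m b)"
    and lact_one: "lact 1 m = m"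
    and ract_one: "ract m 1 = m"

text \<open>
  The norm of a Banach algebra is submultiplicative and complete; \<open>norm 1 = 1\<close> is not required.
  The real scalar multiplication of the type class has to be the restriction of the complex one.
\<close>

locale complex_banach_algebra = complex_algebra scaleA
  for scaleA :: "complex \<Rightarrow> 'a::{real_normed_algebra, monoid_mult, banach} \<Rightarrow> 'a" +
  assumes scale_of_real: "scaleA (of_real r) x = r *\<^sub>R x"
    and norm_scale: "norm (scaleA c x) = cmod c * norm x"

text \<open>The module actions of a Banach bimodule are bounded, not necessarily contractive.\<close>

locale unital_banach_bimodule =
  A: complex_banach_algebra scaleA + unital_bimodule scaleA scaleM lact ract
  for scaleA :: "complex \<Rightarrow> 'a::{real_normed_algebra, monoid_mult, banach} \<Rightarrow> 'a"
    and scaleM :: "complex \<Rightarrow> 'm::banach \<Rightarrow> 'm"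
    and lact :: "'a \<Rightarrow> 'm \<Rightarrow> 'm"
    and ract :: "'m \<Rightarrow> 'a \<Rightarrow> 'm" +
  assumes scaleM_of_real: "scaleM (of_real r) m = r *\<^sub>R m"
    and norm_scaleM: "norm (scaleM c m) = cmod c * norm m"
    and lact_bounded: "\<exists>K. \<forall>a m. norm (lact a m) \<le> K * norm a * norm m"
    and ract_bounded: "\<exists>K. \<forall>a m. norm (ract m a) \<le> K * norm a * norm m"

definition jordan_prod :: "'a::ring \<Rightarrow> 'a \<Rightarrow> 'a"
  where "jordan_prod a b = a * b + b * a"

text \<open>\<open>jordan_act lact ract a m\<close> is both \<open>a \<bullet> m\<close> and \<open>m \<bullet> a\<close>, which agree by definition.\<close>

definition jordan_act ::
    "('a \<Rightarrow> 'm \<Rightarrow> 'm) \<Rightarrow> ('m \<Rightarrow> 'a \<Rightarrow> 'm) \<Rightarrow> 'a \<Rightarrow> 'm::ab_group_add \<Rightarrow> 'm"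
  where "jordan_act lact ract a m = lact a m + ract m a"

definition idempotent_span :: "(complex \<Rightarrow> 'a \<Rightarrow> 'a) \<Rightarrow> 'a::{ring, monoid_mult} set"
  where "idempotent_span scaleA = module.span scaleA {e. e * e = e}"

definition two_sided_ideal :: "(complex \<Rightarrow> 'a \<Rightarrow> 'a) \<Rightarrow> 'a::{ring, monoid_mult} set \<Rightarrow> bool"
  where "two_sided_ideal scaleA J \<longleftrightarrow>
    module.subspace scaleA J \<and> (\<forall>a. \<forall>x\<in>J. a * x \<in> J \<and> x * a \<in> J)"

definition property_M ::
    "(complex \<Rightarrow> 'a::{ring, monoid_mult} \<Rightarrow> 'a) \<Rightarrow> ('a \<Rightarrow> 'm::ab_group_add \<Rightarrow> 'm) \<Rightarrow>
     ('m \<Rightarrow> 'a \<Rightarrow> 'm) \<Rightarrow> bool"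
  where "property_M scaleA lact ract \<longleftrightarrow>
    (\<exists>J. two_sided_ideal scaleA J \<and> J \<subseteq> idempotent_span scaleA \<and>
         {m. \<forall>x\<in>J. ract (lact x m) x = 0} = {0})"

definition property_M' ::
    "(complex \<Rightarrow> 'a::{real_normed_algebra, monoid_mult, banach} \<Rightarrow> 'a) \<Rightarrow>
     ('a \<Rightarrow> 'm::banach \<Rightarrow> 'm) \<Rightarrow> ('m \<Rightarrow> 'a \<Rightarrow> 'm) \<Rightarrow> bool"
  where "property_M' scaleA lact ract \<longleftrightarrow>
    (\<exists>J. two_sided_ideal scaleA J \<and> J \<subseteq> closure (idempotent_span scaleA) \<and>
         {m. \<forall>x\<in>J. ract (lact x m) x = 0} = {0})"

definition generalized_jordan_derivation ::
    "(complex \<Rightarrow> 'a::{ring, monoid_mult} \<Rightarrow> 'a) \<Rightarrow> (complex \<Rightarrow> 'm::ab_group_add \<Rightarrow> 'm) \<Rightarrow>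
     ('a \<Rightarrow> 'm \<Rightarrow> 'm) \<Rightarrow> ('m \<Rightarrow> 'a \<Rightarrow> 'm) \<Rightarrow> ('a \<Rightarrow> 'm) \<Rightarrow> bool"
  where "generalized_jordan_derivation scaleA scaleM lact ract D \<longleftrightarrow>
    Vector_Spaces.linear scaleA scaleM D \<and>
    (\<forall>a b. D (jordan_prod a b) =
       jordan_act lact ract b (D a) + jordan_act lact ract a (D b)
       - ract (lact a (D 1)) b - ract (lact b (D 1)) a)"

end

theory Submission
  imports Defs
begin

text \<open>
  Only the implication from (iii) to (i) has content. If \<open>ab = ba = 0\<close> then \<open>a \<circ> b = 0\<close>, so (ii)
  implies (iii); and if \<open>D(1)\<close> is central, the correction \<open>a D(1) b + b D(1) a = D(1) (a \<circ> b)\<close> in the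
  generalized Jordan identity vanishes when \<open>a \<circ> b = 0\<close>, so (i) implies (ii).

  Assume (iii). For an idempotent \<open>e\<close>, the pair \<open>e, 1 - e\<close> shows that \<open>D(1)\<close> commutes with \<open>e\<close>.
  By linearity, and by continuity in the Banach case, \<open>D(1)\<close> commutes with the ideal \<open>J\<close>. Then
  \<open>x (a D(1) - D(1) a) = 0\<close> for \<open>x \<in> J\<close>, because \<open>x a \<in> J\<close>, and the separation
  property of \<open>J\<close> makes \<open>D(1)\<close> central (\<open>value_at_1_central\<close>).

  Hence \<open>d(a) = D(a) - D(1) a\<close> again satisfies (iii), and \<open>d(1) = 0\<close>. It remains to see that the
  symmetric bilinear defect \<open>w(a, b) = d(a \<circ> b) - a \<bullet> d(b) - b \<bullet> d(a)\<close> is zero. With respect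
  to the Peirce decomposition of an idempotent \<open>e\<close> the following holds:
    \<^item> \<open>w(e, a) = 0\<close>, because (iii) gives it directly for \<open>a\<close> in a diagonal Peirce component, while for an
      off-diagonal \<open>y\<close> both \<open>e\<close> and \<open>e + y\<close> are idempotents and \<open>y\<^sup>2 = 0\<close>
      (\<open>defect_idempotent\<close>);
    \<^item> consequently \<open>w(y, a) = 0\<close> for an off-diagonal \<open>y = (e + y) - e\<close>;
    \<^item> \<open>w\<close> vanishes between the two opposite corners by (iii), and it maps a corner to the
      corresponding corner of the module (\<open>defect_corner\<close>).

  Together these give \<open>w(e \<circ> a, b) = e \<bullet> w(a, b)\<close> (\<open>defect_jordan_prod_idempotent\<close>). Both
  \<open>w(e, a) = 0\<close> and this identity are linear in \<open>e\<close>, hence they hold for \<open>x \<in> J\<close> in place of \<open>e\<close>. But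
  \<open>x \<circ> a \<in> J\<close>, so \<open>x \<bullet> w(a, b) = w(x \<circ> a, b) = 0\<close>. An element \<open>w\<close> with \<open>x w = - w x\<close> for all \<open>x \<in> J\<close>
  satisfies \<open>x\<^sup>2 w = - x w x = w x\<^sup>2\<close> and, as \<open>x\<^sup>2 \<in> J\<close>, also \<open>x\<^sup>2 w = - w x\<^sup>2\<close>. So \<open>x w x = 0\<close> on
  \<open>J\<close>, and \<open>w = 0\<close> by separation (\<open>defect_eq_0\<close>).
\<close>

section \<open>Calculus in a bimodule\<close>

context unital_bimodule
begin

abbreviation jact :: "'a \<Rightarrow> 'm \<Rightarrow> 'm"
  where "jact a m \<equiv> jordan_act lact ract a m"

lemma lact_zero_left [simp]: "lact 0 m = 0"
  using lact_add_left[of 0 0 m] by simp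

lemma lact_zero_right [simp]: "lact a 0 = 0"
  using lact_add_right[of a 0 0] by simp

lemma ract_zero_left [simp]: "ract 0 a = 0"
  using ract_add_left[of 0 0 a] by simp

lemma ract_zero_right [simp]: "ract m 0 = 0"
  using ract_add_right[of m 0 0] by simp

lemma lact_diff_left: "lact (a - b) m = lact a m - lact b m"
  using lact_add_left[of "a - b" b m] by (simp add: eq_diff_eq)

lemma lact_diff_right: "lact a (m - n) = lact a m - lact a n"
  using lact_add_right[of a "m - n" n] by (simp add: eq_diff_eq)

lemma ract_diff_left: "ract (m - n) a = ract m a - ract n a"
  using ract_add_left[of "m - n" n a] by (simp add: eq_diff_eq)

lemma ract_diff_right: "ract m (a - b) = ract m a - ract m b"
  using ract_add_right[of m "a - b" b] by (simp add: eq_diff_eq)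

lemmas bimodule_simps =
  lact_add_left lact_add_right ract_add_left ract_add_right
  lact_diff_left lact_diff_right ract_diff_left ract_diff_right
  lact_mult ract_mult lact_ract lact_one ract_one
  lact_scale_left lact_scale_right ract_scale_left ract_scale_right

lemma double_eq_0:
  fixes m :: 'm
  assumes "m + m = 0"
  shows "m = 0"
proof -
  have "scaleM 2 m = m + m"
    using M.scale_left_distrib[of 1 1 m] by simp
  then show ?thesis
    using assms by simp
qed

lemma double_cancel:
  fixes m n :: 'm
  assumes "m + m = n + n"
  shows "m = n"
  using double_eq_0[of "m - n"] assms by (simp add: algebra_simps)

lemma jact_add_left: "jact (a + b) m = jact a m + jact b m"
  and jact_add_right: "jact a (m + n) = jact a m + jact a n"
  and jact_diff_left: "jact (a - b) m = jact a m - jact b m"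
  and jact_diff_right: "jact a (m - n) = jact a m - jact a n"
  and jact_scale_left: "jact (scaleA k a) m = scaleM k (jact a m)"
  and jact_scale_right: "jact a (scaleM k m) = scaleM k (jact a m)"
  and jact_minus_right: "jact a (- m) = - jact a m"
  and jact_zero_left: "jact 0 m = 0"
  and jact_zero_right: "jact a 0 = 0"
  and jact_one: "jact 1 m = m + m"
  using lact_diff_right[of a 0 m] ract_diff_left[of 0 m a]
  by (simp_all add: jordan_act_def bimodule_simps algebra_simps)

lemmas jact_simps =
  jact_add_left jact_add_right jact_diff_left jact_diff_right
  jact_scale_left jact_scale_right jact_minus_right jact_zero_left jact_zero_right jact_one

lemma jordan_prod_add_left: "jordan_prod (a + b) x = jordan_prod a x + jordan_prod b (x::'a)"
  and jordan_prod_scale_left: "jordan_prod (scaleA k a) x = scaleA k (jordan_prod a x)"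
  and jordan_prod_commute: "jordan_prod a x = jordan_prod x a"
  by (simp_all add: jordan_prod_def A.scale_mult_left A.scale_mult_right algebra_simps)

end

lemma (in complex_algebra) two_sided_idealD:
  assumes "two_sided_ideal scaleA J" "x \<in> J"
  shows "a * x \<in> J" "x * a \<in> J" "jordan_prod x a \<in> J"
  using assms subspace_add
  by (auto simp: two_sided_ideal_def jordan_prod_def)

section \<open>Linear maps that are Jordan derivable at vanishing products\<close>

locale zero_product_derivable = unital_bimodule scaleA scaleM lact ract
  for scaleA :: "complex \<Rightarrow> 'a::{ring, monoid_mult} \<Rightarrow> 'a"
    and scaleM :: "complex \<Rightarrow> 'm::ab_group_add \<Rightarrow> 'm"
    and lact :: "'a \<Rightarrow> 'm \<Rightarrow> 'm"
    and ract :: "'m \<Rightarrow> 'a \<Rightarrow> 'm" +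
  fixes d :: "'a \<Rightarrow> 'm"
  assumes d_linear: "Vector_Spaces.linear scaleA scaleM d"
    and zero_product: "a * b = 0 \<Longrightarrow> b * a = 0 \<Longrightarrow> jact a (d b) + jact b (d a) = 0"
begin

sublocale d: Vector_Spaces.linear scaleA scaleM d
  by (rule d_linear)

lemma idempotent_commutes_with_value_at_1:
  assumes e: "e * e = e"
  shows "lact e (d 1) = ract (d 1) e"
proof -
  have ee: "lact e (lact e m) = lact e m" "ract (ract m e) e = ract m e" for m
    using e by (simp_all flip: lact_mult ract_mult)
  have "jact e (d (1 - e)) + jact (1 - e) (d e) = 0"
    using e by (intro zero_product) (simp_all add: algebra_simps)
  then have z: "jact e (d 1) + (d e + d e) - (jact e (d e) + jact e (d e)) = 0"
    by (simp add: d.diff jact_simps algebra_simps)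
  \<comment> \<open>Compressing \<open>z\<close> to either off-diagonal Peirce component of \<open>e\<close> cancels all values \<open>d e\<close>.\<close>
  have "lact e (d 1) = lact e (ract (d 1) e)"
    using arg_cong[OF z, of "\<lambda>m. lact e m - lact e (ract m e)"]
    by (simp add: jordan_act_def bimodule_simps ee algebra_simps)
  moreover have "ract (d 1) e = lact e (ract (d 1) e)"
    using arg_cong[OF z, of "\<lambda>m. ract m e - lact e (ract m e)"]
    by (simp add: jordan_act_def bimodule_simps ee algebra_simps)
  ultimately show ?thesis
    by simp
qed

definition defect :: "'a \<Rightarrow> 'a \<Rightarrow> 'm"
  where "defect a b = d (jordan_prod a b) - jact a (d b) - jact b (d a)"

lemma defect_commute: "defect a b = defect b a"
  by (simp add: defect_def jordan_prod_commute[of a b])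

lemma defect_add_left: "defect (a + a') b = defect a b + defect a' b"
  by (simp add: defect_def jordan_prod_add_left d.add jact_simps algebra_simps)

lemma defect_scale_left: "defect (scaleA k a) b = scaleM k (defect a b)"
  by (simp add: defect_def jordan_prod_scale_left d.scale jact_simps algebra_simps)

lemma defect_add_right: "defect a (b + b') = defect a b + defect a b'"
  by (metis defect_add_left defect_commute)

lemma defect_zero_product:
  assumes "a * b = 0" "b * a = 0"
  shows "defect a b = 0"
  using zero_product[OF assms] assms
  by (simp add: defect_def jordan_prod_def diff_diff_eq del: diff_0)

lemma defect_idempotent_self:
  assumes "d 1 = 0" "e * e = e"
  shows "defect e e = 0"
proof (rule double_eq_0)
  have "jact e (d (1 - e)) + jact (1 - e) (d e) = 0"
    using assms by (intro zero_product) (simp_all add: algebra_simps)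
  then have "d e + d e - jact e (d e) - jact e (d e) = 0"
    using assms(1) by (simp add: d.neg d.diff jact_simps algebra_simps)
  then show "defect e e + defect e e = 0"
    using assms(2) by (simp add: defect_def jordan_prod_def d.add algebra_simps)
qed

text \<open>
  The last two hypotheses say that \<open>y\<close> behaves like an off-diagonal element for \<open>e\<close>. Then \<open>e + y\<close> is again an
  idempotent, and polarizing the vanishing of \<open>w(e + y, e + y)\<close> leaves \<open>2 w(e, y)\<close>.
\<close>

lemma defect_idempotent_nilpotent:
  assumes "d 1 = 0" "e * e = e" "y * y = 0" "e * y + y * e = y"
  shows "defect e y = 0"
proof (rule double_eq_0)
  have "(e + y) * (e + y) = e + y"
    using assms(2-4) by (simp add: distrib_left distrib_right add_ac)
  then have "defect (e + y) (e + y) = 0"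
    by (rule defect_idempotent_self[OF assms(1)])
  then show "defect e y + defect e y = 0"
    using defect_idempotent_self[OF assms(1,2)] defect_zero_product[OF assms(3,3)]
    by (simp add: defect_add_left defect_add_right defect_commute[of y e])
qed

lemma peirce_decomposition:
  fixes a e :: 'a
  shows "a = e * a * e + e * a * (1 - e) + (1 - e) * a * e + (1 - e) * a * (1 - e)"
  by (simp add: algebra_simps)

lemma idempotent_complement:
  fixes e :: 'a
  assumes e: "e * e = e"
  shows "(1 - e) * (1 - e) = 1 - e" "e * (1 - e) = 0" "(1 - e) * e = 0"
    "e * (e * a) = e * a" "e * ((1 - e) * a) = 0" "(1 - e) * (e * a) = 0"
    "(1 - e) * ((1 - e) * a) = (1 - e) * a"
  using e by (simp_all add: algebra_simps flip: mult.assoc)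

text \<open>
  Only the Peirce component \<open>e a e\<close> still needs an argument: it annihilates \<open>1 - e\<close>, so its defect with \<open>e\<close> is
  its defect with \<open>1\<close>, and that is zero because \<open>d\<close> vanishes at \<open>1\<close>.
\<close>

lemma defect_idempotent:
  assumes d1: "d 1 = 0" and e: "e * e = e"
  shows "defect e a = 0"
proof -
  note s = idempotent_complement[OF e] e mult.assoc
  have "defect e (e * a * (1 - e)) = 0" "defect e ((1 - e) * a * e) = 0"
    by (rule defect_idempotent_nilpotent[OF d1 e]; simp add: s)+
  moreover have "defect e ((1 - e) * a * (1 - e)) = 0"
    by (rule defect_zero_product) (simp_all add: s)
  moreover have "defect e (e * a * e) = 0"
  proof -
    have "defect (1 - e) (e * a * e) = 0"
      by (rule defect_zero_product) (simp_all add: s)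
    moreover have "defect 1 b = 0" for b
      using d1 by (simp add: defect_def jordan_prod_def d.add jact_simps)
    ultimately show ?thesis
      using defect_add_left[of e "1 - e" "e * a * e"] by simp
  qed
  ultimately show ?thesis
    by (subst peirce_decomposition[of a e]) (simp only: defect_add_right add_0)
qed

text \<open>Off-diagonal elements are differences of the idempotents \<open>e + y\<close> and \<open>e\<close>.\<close>

lemma defect_off_diagonal:
  assumes d1: "d 1 = 0" and e: "e * e = e"
  shows "defect (e * a * (1 - e)) b = 0" "defect ((1 - e) * a * e) b = 0"
proof -
  have "defect y b = 0" if "(e + y) * (e + y) = e + y" for y
    using defect_idempotent[OF d1 that, of b] defect_idempotent[OF d1 e, of b]
    by (simp add: defect_add_left)
  then show "defect (e * a * (1 - e)) b = 0" "defect ((1 - e) * a * e) b = 0"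
    using idempotent_complement[OF e] e by (simp_all add: mult.assoc distrib_left distrib_right)
qed

text \<open>
  On the corner \<open>e A e\<close>, the part of \<open>d a\<close> that leaves the corresponding corner of the module is determined
  by \<open>d e\<close> alone: with \<open>f = 1 - e\<close> one has \<open>f d(a) = f d(e) a\<close> and \<open>d(a) f = a d(e) f\<close>. To see the
  first, multiply \<open>2 d(a) = e \<bullet> d(a) + a \<bullet> d(e)\<close> by \<open>f\<close> on the left to get
  \<open>2 f d(a) = f d(a) e + f d(e) a\<close>, and compare with the result of a multiplication by \<open>e\<close> on the
  right, which shows that the two summands are equal.
\<close>

lemma complement_value_in_corner:
  assumes d1: "d 1 = 0" and e: "e * e = e" and a: "e * a = a" "a * e = a"
  shows "d a - lact e (d a) = ract (d e - lact e (d e)) a"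
    and "d a - ract (d a) e = lact a (d e - ract (d e) e)"
proof -
  have ee: "lact e (lact e m) = lact e m" "ract (ract m e) e = ract m e"
    "lact e (lact a m) = lact a m" "ract (ract m a) e = ract m a"
    "lact a (lact e m) = lact a m" "ract (ract m e) a = ract m a" for m
    using e a by (simp_all flip: lact_mult ract_mult)
  have R: "d a + d a - jact e (d a) - jact a (d e) = 0"
    using defect_idempotent[OF d1 e, of a] a by (simp add: defect_def jordan_prod_def d.add)
  define Z where "Z = d a - lact e (d a)"
  define V where "V = ract (d e - lact e (d e)) a"
  have 1: "Z + Z = ract Z e + V"
    using arg_cong[OF R, of "\<lambda>m. m - lact e m"]
    by (simp add: Z_def V_def jordan_act_def bimodule_simps ee algebra_simps)
  have "ract Z e = V"
    using arg_cong[OF 1, of "\<lambda>m. ract m e"]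
    by (simp add: V_def bimodule_simps ee)
  then show "d a - lact e (d a) = ract (d e - lact e (d e)) a"
    using 1 double_cancel unfolding Z_def V_def by metis
  define Z' where "Z' = d a - ract (d a) e"
  define V' where "V' = lact a (d e - ract (d e) e)"
  have 2: "Z' + Z' = lact e Z' + V'"
    using arg_cong[OF R, of "\<lambda>m. m - ract m e"]
    by (simp add: Z'_def V'_def jordan_act_def bimodule_simps ee algebra_simps)
  have "lact e Z' = V'"
    using arg_cong[OF 2, of "\<lambda>m. lact e m"]
    by (simp add: V'_def bimodule_simps ee)
  then show "d a - ract (d a) e = lact a (d e - ract (d e) e)"
    using 2 double_cancel unfolding Z'_def V'_def by metis
qed

text \<open>
  By the formula \<open>f d(a) = f d(e) a\<close>, used for \<open>a\<close>, \<open>b\<close> and \<open>a \<circ> b\<close>, the terms of \<open>f w(a, b)\<close> cancel; the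
  mirrored formula does the same for \<open>w(a, b) f\<close>. So the defect lies in the corner of the module, where \<open>e\<close> acts as a
  unit on both sides.
\<close>

lemma defect_corner:
  assumes d1: "d 1 = 0" and e: "e * e = e"
    and a: "e * a = a" "a * e = a" and b: "e * b = b" "b * e = b"
  shows "jact e (defect a b) = defect a b + defect a b"
proof -
  have ab: "e * jordan_prod a b = jordan_prod a b" "jordan_prod a b * e = jordan_prod a b"
    using a b by (simp_all add: jordan_prod_def distrib_left distrib_right mult.assoc)
      (simp_all flip: mult.assoc)
  note corner = complement_value_in_corner[OF d1 e]
  have ee: "lact e (lact a m) = lact a m" "ract (ract m a) e = ract m a"
     "lact e (lact b m) = lact b m" "ract (ract m b) e = ract m b" for m
    using a b by (simp_all flip: lact_mult ract_mult)
  have "defect a b - lact e (defect a b) =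
      (d (jordan_prod a b) - lact e (d (jordan_prod a b)))
      - ract (d b - lact e (d b)) a - ract (d a - lact e (d a)) b"
    by (simp add: defect_def jordan_act_def bimodule_simps ee algebra_simps)
  also have "\<dots> = 0"
    unfolding corner(1)[OF ab] corner(1)[OF a] corner(1)[OF b]
    by (simp add: jordan_prod_def ract_add_right ract_mult)
  finally have l: "lact e (defect a b) = defect a b"
    by simp
  have "defect a b - ract (defect a b) e =
      (d (jordan_prod a b) - ract (d (jordan_prod a b)) e)
      - lact a (d b - ract (d b) e) - lact b (d a - ract (d a) e)"
    by (simp add: defect_def jordan_act_def bimodule_simps ee algebra_simps)
  also have "\<dots> = 0"
    unfolding corner(2)[OF ab] corner(2)[OF a] corner(2)[OF b]
    by (simp add: jordan_prod_def lact_add_left lact_mult)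
  finally have "ract (defect a b) e = defect a b"
    by simp
  with l show ?thesis
    by (simp add: jordan_act_def)
qed

text \<open>
  This is the step that makes ideals useful: it is linear in \<open>e\<close>, and it trades a factor acting on the defect for a
  factor inside its argument. Both sides equal \<open>2 w(e a e, e b e)\<close>, since \<open>w(a, b)\<close> is the sum of the defects of the
  two diagonal corners and \<open>e\<close> annihilates the second one.
\<close>

lemma defect_jordan_prod_idempotent:
  assumes d1: "d 1 = 0" and e: "e * e = e"
  shows "defect (jordan_prod e a) b = jact e (defect a b)"
proof -
  let ?f = "1 - e"
  note s = idempotent_complement[OF e] e mult.assoc
  have f: "?f * ?f = ?f"
    by (simp add: s)
  have off: "defect (e * x * ?f) y = 0" "defect (?f * x * e) y = 0"
     "defect y (e * x * ?f) = 0" "defect y (?f * x * e) = 0" for x y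
    using defect_off_diagonal[OF d1 e] by (simp_all add: defect_commute[of y])
  have cross: "defect (e * x * e) (?f * y * ?f) = 0" "defect (?f * x * ?f) (e * y * e) = 0" for x y
    by (rule defect_zero_product; simp add: s)+
  have right: "defect (e * a * e) b = defect (e * a * e) (e * b * e)"
    by (subst peirce_decomposition[of b e]) (simp only: defect_add_right off cross add_0_right)
  have split: "defect a b = defect (e * a * e) (e * b * e) + defect (?f * a * ?f) (?f * b * ?f)"
    by (subst peirce_decomposition[of a e], subst peirce_decomposition[of b e])
      (simp only: defect_add_left defect_add_right off cross add_0_right add_0_left)
  have "jordan_prod e a = e * a * e + e * a * e + e * a * ?f + ?f * a * e"
    by (simp add: jordan_prod_def algebra_simps)
  then have "defect (jordan_prod e a) b = defect (e * a * e) b + defect (e * a * e) b"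
    by (simp only: defect_add_left off add_0_right)
  moreover have "jact e (defect (e * a * e) (e * b * e)) =
      defect (e * a * e) (e * b * e) + defect (e * a * e) (e * b * e)"
    by (rule defect_corner[OF d1 e]) (simp_all add: s)
  moreover have "jact ?f (defect (?f * a * ?f) (?f * b * ?f)) =
      defect (?f * a * ?f) (?f * b * ?f) + defect (?f * a * ?f) (?f * b * ?f)"
    by (rule defect_corner[OF d1 f]) (simp_all add: s)
  then have "jact e (defect (?f * a * ?f) (?f * b * ?f)) = 0"
    unfolding jact_diff_left jact_one by simp
  ultimately show ?thesis
    unfolding split right by (simp add: jact_add_right)
qed

end

section \<open>From idempotents to a separating ideal\<close>

text \<open>
  The algebraic and the Banach setting differ only in which linear maps vanish on \<open>J\<close> once they vanish on
  all idempotents: all of them if \<open>J\<close> is contained in the span of the idempotents, the continuous ones if it is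
  contained in the closure of that span. The predicate \<open>adm\<close> stands for either class; the closure
  conditions are those that make \<open>a \<mapsto> w(a, b)\<close> and the related maps belong to it.
\<close>

locale idempotent_determined_ideal = unital_bimodule scaleA scaleM lact ract
  for scaleA :: "complex \<Rightarrow> 'a::{ring, monoid_mult} \<Rightarrow> 'a"
    and scaleM :: "complex \<Rightarrow> 'm::ab_group_add \<Rightarrow> 'm"
    and lact :: "'a \<Rightarrow> 'm \<Rightarrow> 'm"
    and ract :: "'m \<Rightarrow> 'a \<Rightarrow> 'm" +
  fixes adm :: "('a \<Rightarrow> 'm) \<Rightarrow> bool"
    and J :: "'a set"
  assumes ideal: "two_sided_ideal scaleA J"
    and separating: "(\<And>x. x \<in> J \<Longrightarrow> ract (lact x m) x = 0) \<Longrightarrow> m = 0"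
    and determined: "Vector_Spaces.linear scaleA scaleM G \<Longrightarrow> adm G \<Longrightarrow>
      (\<And>e. e * e = e \<Longrightarrow> G e = 0) \<Longrightarrow> x \<in> J \<Longrightarrow> G x = 0"
    and adm_lact_arg: "adm (\<lambda>x. lact x m)"
    and adm_ract_arg: "adm (\<lambda>x. ract m x)"
    and adm_add: "adm F \<Longrightarrow> adm G \<Longrightarrow> adm (\<lambda>x. F x + G x)"
    and adm_diff: "adm F \<Longrightarrow> adm G \<Longrightarrow> adm (\<lambda>x. F x - G x)"
    and adm_lact: "adm G \<Longrightarrow> adm (\<lambda>x. lact a (G x))"
    and adm_ract: "adm G \<Longrightarrow> adm (\<lambda>x. ract (G x) a)"
    and adm_jordan_prod: "adm G \<Longrightarrow> adm (\<lambda>x. G (jordan_prod x a))"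
begin

lemmas adm_intros = adm_lact_arg adm_ract_arg adm_add adm_diff adm_lact adm_ract adm_jordan_prod

lemma value_at_1_central:
  assumes "zero_product_derivable scaleA scaleM lact ract D"
  shows "lact a (D 1) = ract (D 1) a"
proof -
  interpret D: zero_product_derivable scaleA scaleM lact ract D
    by (rule assms)
  have J: "lact x (D 1) = ract (D 1) x" if "x \<in> J" for x
  proof -
    have "lact x (D 1) - ract (D 1) x = 0"
    proof (rule determined[OF _ _ _ that])
      show "Vector_Spaces.linear scaleA scaleM (\<lambda>x. lact x (D 1) - ract (D 1) x)"
        by unfold_locales (simp_all add: bimodule_simps M.scale_right_diff_distrib)
    qed (simp_all add: adm_intros D.idempotent_commutes_with_value_at_1)
    then show ?thesis
      by simp
  qed
  have "lact a (D 1) - ract (D 1) a = 0"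
  proof (rule separating)
    fix x assume x: "x \<in> J"
    \<comment> \<open>\<open>x a c = c x a = x c a\<close> for \<open>c = D 1\<close>, because both \<open>x\<close> and \<open>x a\<close> lie in \<open>J\<close>.\<close>
    have "lact x (lact a (D 1)) = lact x (ract (D 1) a)"
      using J[OF x] J[OF A.two_sided_idealD(2)[OF ideal x, of a]]
      by (simp add: lact_mult ract_mult flip: lact_ract)
    then show "ract (lact x (lact a (D 1) - ract (D 1) a)) x = 0"
      by (simp add: lact_diff_right)
  qed
  then show ?thesis
    by simp
qed

lemma defect_eq_0:
  assumes "zero_product_derivable scaleA scaleM lact ract d" and d1: "d 1 = 0" and adm: "adm d"
  shows "d (jordan_prod a b) = jact a (d b) + jact b (d a)"
proof -
  interpret d: zero_product_derivable scaleA scaleM lact ract d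
    by (rule assms)
  have adm_defect: "adm (\<lambda>x. d.defect x c)" for c
    unfolding d.defect_def jordan_act_def by (intro adm_intros adm)
  have "Vector_Spaces.linear scaleA scaleM (\<lambda>x. d.defect x c)" for c
    by unfold_locales (simp_all add: d.defect_add_left d.defect_scale_left)
  then have J: "d.defect x c = 0" if "x \<in> J" for x c
    by (rule determined[OF _ adm_defect d.defect_idempotent[OF d1] that])
  have "d.defect a b = 0"
  proof (rule separating)
    fix x assume x: "x \<in> J"
    let ?w = "d.defect a b"
    \<comment> \<open>The ideal property puts \<open>y \<circ> a\<close> into \<open>J\<close>, where the defect is already known to vanish.\<close>
    have anti: "lact y ?w = - ract ?w y" if "y \<in> J" for y
    proof -
      have "d.defect (jordan_prod y a) b - jact y ?w = 0"
      proof (rule determined[OF _ _ _ that])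
        show "Vector_Spaces.linear scaleA scaleM
            (\<lambda>y. d.defect (jordan_prod y a) b - jact y ?w)"
          by unfold_locales (simp_all add: jordan_prod_add_left jordan_prod_scale_left
              d.defect_add_left d.defect_scale_left jact_simps M.scale_right_diff_distrib)
        show "adm (\<lambda>y. d.defect (jordan_prod y a) b - jact y ?w)"
          unfolding jordan_act_def
          by (intro adm_diff adm_jordan_prod[of "\<lambda>x. d.defect x b"] adm_defect adm_add
              adm_lact_arg adm_ract_arg)
      qed (simp add: d.defect_jordan_prod_idempotent[OF d1])
      then have "jact y ?w = 0"
        unfolding J[OF A.two_sided_idealD(3)[OF ideal that]] diff_0 neg_equal_0_iff_equal .
      then show ?thesis
        by (simp only: jordan_act_def eq_neg_iff_add_eq_0)
    qed
    \<comment> \<open>Moving \<open>x\<close> twice past \<open>w\<close> changes the sign twice, moving \<open>x\<^sup>2 \<in> J\<close> once changes it once.\<close>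
    have "lact x (lact x ?w) = - ract (ract ?w x) x"
      using anti[OF A.two_sided_idealD(1)[OF ideal x, of x]] by (simp add: lact_mult ract_mult)
    moreover have "ract (lact x ?w) x = - ract (ract ?w x) x"
      using anti[OF x] ract_diff_left[of 0 "ract ?w x" x] by simp
    moreover have "lact x (lact x ?w) = - lact x (ract ?w x)"
      using anti[OF x] lact_diff_right[of x 0 "ract ?w x"] by simp
    ultimately have "ract (lact x ?w) x = - ract (lact x ?w) x"
      unfolding lact_ract by metis
    then show "ract (lact x ?w) x = 0"
      unfolding eq_neg_iff_add_eq_0 by (rule double_eq_0)
  qed
  then show ?thesis
    by (simp add: d.defect_def algebra_simps)
qed

lemma zero_product_imp_generalized_jordan:
  assumes "zero_product_derivable scaleA scaleM lact ract D" and adm: "adm D"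
  shows "generalized_jordan_derivation scaleA scaleM lact ract D"
proof -
  interpret D: zero_product_derivable scaleA scaleM lact ract D
    by (rule assms)
  define c where "c = D 1"
  have c: "lact a c = ract c a" for a
    unfolding c_def by (rule value_at_1_central[OF assms(1)])
  have c': "lact a (ract c b) = ract (ract c a) b" for a b
    using c by (simp flip: lact_ract)
  \<comment> \<open>Since \<open>c\<close> is central, subtracting \<open>a \<mapsto> c a\<close> preserves the hypothesis on zero products.\<close>
  define d where "d = (\<lambda>a. D a - ract c a)"
  have "zero_product_derivable scaleA scaleM lact ract d"
  proof unfold_locales
    fix a b :: 'a
    assume ab: "a * b = 0" "b * a = 0"
    then have "ract (ract c a) b = 0" "ract (ract c b) a = 0"
      by (simp_all flip: ract_mult)
    with D.zero_product[OF ab] show "jact a (d b) + jact b (d a) = 0"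
      by (simp add: d_def jordan_act_def bimodule_simps c c' algebra_simps)
  qed (simp_all add: d_def D.d.add D.d.scale bimodule_simps M.scale_right_diff_distrib)
  moreover have "d 1 = 0"
    by (simp add: d_def c_def ract_one)
  moreover have "adm d"
    unfolding d_def by (intro adm_intros adm)
  ultimately have "d (jordan_prod a b) = jact a (d b) + jact b (d a)" for a b
    by (rule defect_eq_0)
  then have "D (jordan_prod a b) = jact b (D a) + jact a (D b)
      - ract (lact a (D 1)) b - ract (lact b (D 1)) a" for a b
    unfolding d_def by (simp add: jordan_prod_def jordan_act_def bimodule_simps c c'
        algebra_simps flip: c_def)
  then show ?thesis
    using D.d_linear by (simp add: generalized_jordan_derivation_def)
qed

end

section \<open>The equivalence in the algebraic and in the Banach setting\<close>

lemma (in unital_bimodule) generalized_jordan_imp_jordan_zero_product: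
  assumes "generalized_jordan_derivation scaleA scaleM lact ract D"
    and central: "\<And>a. lact a (D 1) = ract (D 1) a"
    and ab: "jordan_prod a b = 0"
  shows "jact a (D b) + jact b (D a) = 0"
proof -
  interpret D: Vector_Spaces.linear scaleA scaleM D
    using assms(1) by (simp add: generalized_jordan_derivation_def)
  have "ract (lact a (D 1)) b + ract (lact b (D 1)) a = ract (D 1) (jordan_prod a b)"
    by (simp add: jordan_prod_def central ract_add_right ract_mult)
  moreover have "D (jordan_prod a b) = jact b (D a) + jact a (D b)
      - ract (lact a (D 1)) b - ract (lact b (D 1)) a"
    using assms(1) by (simp add: generalized_jordan_derivation_def)
  ultimately show ?thesis
    using ab D.zero by (simp add: algebra_simps)
qed

lemma (in idempotent_determined_ideal) zero_product_characterizations: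
  assumes lin: "Vector_Spaces.linear scaleA scaleM D" and adm: "adm D"
  shows "((generalized_jordan_derivation scaleA scaleM lact ract D \<and>
          (\<forall>a. lact a (D 1) = ract (D 1) a))
        \<longleftrightarrow> (\<forall>a b. jordan_prod a b = 0 \<longrightarrow> jact a (D b) + jact b (D a) = 0))
     \<and> ((\<forall>a b. jordan_prod a b = 0 \<longrightarrow> jact a (D b) + jact b (D a) = 0)
        \<longleftrightarrow> (\<forall>a b. a * b = 0 \<and> b * a = 0 \<longrightarrow> jact a (D b) + jact b (D a) = 0))"
    (is "(?i \<longleftrightarrow> ?ii) \<and> (?ii \<longleftrightarrow> ?iii)")
proof -
  have "?i \<Longrightarrow> ?ii"
    using generalized_jordan_imp_jordan_zero_product by blast
  moreover have "?ii \<Longrightarrow> ?iii"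
    by (simp add: jordan_prod_def)
  moreover have ?i if ?iii
  proof -
    interpret D: Vector_Spaces.linear scaleA scaleM D
      by (rule lin)
    have "zero_product_derivable scaleA scaleM lact ract D"
      by unfold_locales (use that in blast)
    then show ?i
      using zero_product_imp_generalized_jordan value_at_1_central adm by blast
  qed
  ultimately show ?thesis
    by blast
qed

lemma (in unital_bimodule) idempotent_determined_span:
  assumes "Vector_Spaces.linear scaleA scaleM G" "\<And>e. e * e = e \<Longrightarrow> G e = 0"
    and "x \<in> idempotent_span scaleA"
  shows "G x = 0"
proof -
  interpret G: Vector_Spaces.linear scaleA scaleM G
    by (rule assms)
  show ?thesis
    using assms(2,3) G.eq_0_on_span[of "{e. e * e = e}" x] by (simp add: idempotent_span_def)
qed

lemma (in unital_bimodule) idempotent_determined_if_property_M: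
  assumes "property_M scaleA lact ract"
  obtains J where "idempotent_determined_ideal scaleA scaleM lact ract (\<lambda>_. True) J"
proof -
  obtain J where J: "two_sided_ideal scaleA J" "J \<subseteq> idempotent_span scaleA"
      "{m. \<forall>x\<in>J. ract (lact x m) x = 0} = {0}"
    using assms by (auto simp: property_M_def)
  have "idempotent_determined_ideal scaleA scaleM lact ract (\<lambda>_. True) J"
    using J idempotent_determined_span by unfold_locales blast+
  then show thesis
    by (rule that)
qed

context unital_banach_bimodule
begin

lemma bounded_linear_lact_arg: "bounded_linear (\<lambda>a. lact a m)"
  and bounded_linear_lact: "bounded_linear (\<lambda>m. lact a m)"
proof -
  obtain K where K: "\<And>a m. norm (lact a m) \<le> K * norm a * norm m"
    using lact_bounded by blast
  show "bounded_linear (\<lambda>a. lact a m)"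
    by (rule bounded_linear_intro[where K = "K * norm m"])
      (use K in \<open>simp_all add: lact_add_left lact_scale_left mult_ac
        flip: A.scale_of_real scaleM_of_real\<close>)
  show "bounded_linear (\<lambda>m. lact a m)"
    by (rule bounded_linear_intro[where K = "K * norm a"])
      (use K in \<open>simp_all add: lact_add_right lact_scale_right mult_ac flip: scaleM_of_real\<close>)
qed

lemma bounded_linear_ract_arg: "bounded_linear (\<lambda>a. ract m a)"
  and bounded_linear_ract: "bounded_linear (\<lambda>m. ract m a)"
proof -
  obtain K where K: "\<And>a m. norm (ract m a) \<le> K * norm a * norm m"
    using ract_bounded by blast
  show "bounded_linear (\<lambda>a. ract m a)"
    by (rule bounded_linear_intro[where K = "K * norm m"])
      (use K in \<open>simp_all add: ract_add_right ract_scale_right mult_ac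
        flip: A.scale_of_real scaleM_of_real\<close>)
  show "bounded_linear (\<lambda>m. ract m a)"
    by (rule bounded_linear_intro[where K = "K * norm a"])
      (use K in \<open>simp_all add: ract_add_left ract_scale_left mult_ac flip: scaleM_of_real\<close>)
qed

lemma idempotent_determined_if_property_M':
  assumes "property_M' scaleA lact ract"
  obtains J where "idempotent_determined_ideal scaleA scaleM lact ract (continuous_on UNIV) J"
proof -
  obtain J where J: "two_sided_ideal scaleA J" "J \<subseteq> closure (idempotent_span scaleA)"
      "{m. \<forall>x\<in>J. ract (lact x m) x = 0} = {0}"
    using assms by (auto simp: property_M'_def)
  have "idempotent_determined_ideal scaleA scaleM lact ract (continuous_on UNIV) J"
  proof unfold_locales
    fix G x
    assume G: "Vector_Spaces.linear scaleA scaleM G" "continuous_on UNIV G"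
      "\<And>e. e * e = e \<Longrightarrow> G e = 0" and x: "x \<in> J"
    have "idempotent_span scaleA \<subseteq> {x. G x = 0}"
      using idempotent_determined_span[OF G(1,3)] by blast
    moreover have "closed {x. G x = 0}"
      using G(2) by (rule closed_Collect_eq) (rule continuous_on_const)
    ultimately show "G x = 0"
      using closure_minimal J(2) x by blast
  next
    fix G :: "'a \<Rightarrow> 'm" and a
    assume "continuous_on UNIV G"
    then show "continuous_on UNIV (\<lambda>x. G (jordan_prod x a))"
      unfolding jordan_prod_def
      by (rule continuous_on_compose2) (intro continuous_intros subset_UNIV)+
  next
    fix m
    assume "\<And>x. x \<in> J \<Longrightarrow> ract (lact x m) x = 0"
    then show "m = 0"
      using J(3) by blast
  next
    fix G :: "'a \<Rightarrow> 'm" and a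
    assume G: "continuous_on UNIV G"
    show "continuous_on UNIV (\<lambda>x. lact a (G x))"
      by (rule bounded_linear.continuous_on[OF bounded_linear_lact G])
    show "continuous_on UNIV (\<lambda>x. ract (G x) a)"
      by (rule bounded_linear.continuous_on[OF bounded_linear_ract G])
  qed (rule J(1) linear_continuous_on bounded_linear_lact_arg bounded_linear_ract_arg
      continuous_on_add continuous_on_diff; assumption?)+
  then show thesis
    by (rule that)
qed

end

theorem theorem4p3:
  fixes scaleA :: "complex \<Rightarrow> 'a::{ring, monoid_mult} \<Rightarrow> 'a"
    and scaleM :: "complex \<Rightarrow> 'm::ab_group_add \<Rightarrow> 'm"
    and lact :: "'a \<Rightarrow> 'm \<Rightarrow> 'm"
    and ract :: "'m \<Rightarrow> 'a \<Rightarrow> 'm"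
    and D :: "'a \<Rightarrow> 'm"
    and scaleB :: "complex \<Rightarrow> 'b::{real_normed_algebra, monoid_mult, banach} \<Rightarrow> 'b"
    and scaleN :: "complex \<Rightarrow> 'n::banach \<Rightarrow> 'n"
    and lactN :: "'b \<Rightarrow> 'n \<Rightarrow> 'n"
    and ractN :: "'n \<Rightarrow> 'b \<Rightarrow> 'n"
    and E :: "'b \<Rightarrow> 'n"
  shows
    "(unital_bimodule scaleA scaleM lact ract \<and> property_M scaleA lact ract \<and>
      Vector_Spaces.linear scaleA scaleM D \<longrightarrow>
      ((generalized_jordan_derivation scaleA scaleM lact ract D \<and> (\<forall>a. lact a (D 1) = ract (D 1) a))
        \<longleftrightarrow> (\<forall>a b. jordan_prod a b = 0 \<longrightarrow>
            jordan_act lact ract a (D b) + jordan_act lact ract b (D a) = 0))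
     \<and> ((\<forall>a b. jordan_prod a b = 0 \<longrightarrow>
            jordan_act lact ract a (D b) + jordan_act lact ract b (D a) = 0)
        \<longleftrightarrow> (\<forall>a b. a * b = 0 \<and> b * a = 0 \<longrightarrow>
            jordan_act lact ract a (D b) + jordan_act lact ract b (D a) = 0)))
   \<and>
     (unital_banach_bimodule scaleB scaleN lactN ractN \<and> property_M' scaleB lactN ractN \<and>
      Vector_Spaces.linear scaleB scaleN E \<and> continuous_on UNIV E \<longrightarrow>
      ((generalized_jordan_derivation scaleB scaleN lactN ractN E \<and> (\<forall>a. lactN a (E 1) = ractN (E 1) a))
        \<longleftrightarrow> (\<forall>a b. jordan_prod a b = 0 \<longrightarrow>
            jordan_act lactN ractN a (E b) + jordan_act lactN ractN b (E a) = 0))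
     \<and> ((\<forall>a b. jordan_prod a b = 0 \<longrightarrow>
            jordan_act lactN ractN a (E b) + jordan_act lactN ractN b (E a) = 0)
        \<longleftrightarrow> (\<forall>a b. a * b = 0 \<and> b * a = 0 \<longrightarrow>
            jordan_act lactN ractN a (E b) + jordan_act lactN ractN b (E a) = 0)))"
  (is "(?premises_a \<longrightarrow> ?conclusion_a) \<and> (?premises_b \<longrightarrow> ?conclusion_b)")
proof (rule conjI; rule impI; elim conjE)
  assume "unital_bimodule scaleA scaleM lact ract" "property_M scaleA lact ract"
    and D: "Vector_Spaces.linear scaleA scaleM D"
  then interpret unital_bimodule scaleA scaleM lact ract
    by simp
  obtain J where "idempotent_determined_ideal scaleA scaleM lact ract (\<lambda>_. True) J"
    using idempotent_determined_if_property_M \<open>property_M scaleA lact ract\<close> by blast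
  then interpret idempotent_determined_ideal scaleA scaleM lact ract "\<lambda>_. True" J .
  show "?conclusion_a"
    by (rule zero_product_characterizations[OF D]) simp
next
  assume "unital_banach_bimodule scaleB scaleN lactN ractN" "property_M' scaleB lactN ractN"
    and E: "Vector_Spaces.linear scaleB scaleN E" "continuous_on UNIV E"
  then interpret unital_banach_bimodule scaleB scaleN lactN ractN
    by simp
  obtain J where "idempotent_determined_ideal scaleB scaleN lactN ractN (continuous_on UNIV) J"
    using idempotent_determined_if_property_M' \<open>property_M' scaleB lactN ractN\<close> by blast
  then interpret idempotent_determined_ideal scaleB scaleN lactN ractN "continuous_on UNIV" J .
  show "?conclusion_b"
    by (rule zero_product_characterizations[OF E])
qed

end
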